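(* Let $\alpha=0$, $0\le\beta<\infty$, and let $\Gamma$ be a Hermitian $2\times2$ matrix, $\Gamma\neq -R$. The part of the singular spectrum of $H(\Gamma)$ below the threshold $-\beta$ is the set $$\Bigl\{E<-\beta:\ \gamma=\prod_{s=\pm}\bigl(\omega_s+\sqrt{s\beta-E}\bigr)\Bigr\}.$$ For $\beta>0$, the singular spectrum embedded in the continuous spectrum $[-\beta,\infty)$ is described by the following singletons: (i) $\{-\beta\}$ iff $\gamma=(\omega_++\sqrt{2\beta})\,\omega_-$; (ii) $\{\beta-\omega_+^2\}$ iff $\gamma=0$ and $-\sqrt{2\beta}<\omega_+<0$; (iii) $\{\beta\}$ iff $\gamma=\omega_-=0$. For $\beta=0$ there are no embedded eigenvalues.
   Context: Operators ($\alpha=0$). In $L^2(\mathbb R^3)\otimes\mathbb C^2$ let $H=-\Delta\otimes I+\beta I\otimes\sigma_3$ on $H^2(\mathbb R^3)\otimes\mathbb C^2$ (self-adjoint, spectrum $[-\beta,\infty)$), where $\sigma_3=\mathrm{diag}(1,-1)$, and let $H^0$ be its restriction to $\{f\in \mathrm{dom}\,H: f(0)=0\}$. Indices $s,s'$ take values $\pm$ (identified with $\pm1$). Put $g_+=(1,0)^T$, $g_-=(0,1)^T$, $\psi_s=\mathcal N_s\,\delta\otimes g_s$ ($\delta$ the Dirac distribution at $0$), with $\mathcal N_s=2\sqrt[4]{2}\sqrt\pi\,(\sqrt{1+\beta^2}+s\beta)^{1/4}$, and $\Phi_s(z)=(H-z)^{-1}\psi_s$. Each $f\in\mathrm{dom}\,H^{0*}$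 is uniquely $f=\tilde f+\frac12\sum_s b_s(f)(\Phi_s(i)+\Phi_s(-i))$ with $\tilde f\in\mathrm{dom}\,H$, $b_s(f)\in\mathbb C$; $b(f)=(b_s(f))_s$ and $\langle\psi,\tilde f\rangle=(\langle\psi_s,\tilde f\rangle)_s$ are column vectors. $R$ is a fixed Hermitian $2\times 2$ matrix (the "admissible matrix"). $H(\Gamma)$ is the self-adjoint restriction of $H^{0*}$ to $\{f\in\mathrm{dom}\,H^{0*}:\langle\psi,\tilde f\rangle=\Gamma b(f)\}$, where $\Gamma=(\Gamma_{ss'})$ is Hermitian, written $\Gamma=-C^{-1}-R$ with $C$ the (invertible Hermitian) coupling matrix. Notation: $\tilde\Gamma_{ss'}=\Gamma_{ss'}/(\mathcal N_s\mathcal N_{s'})$, $\Lambda_s=-\frac1{8\pi}\bigl(\sqrt{\sqrt{1+\beta^2}+1}+s\sqrt{\sqrt{1+\beta^2}-1}\bigr)$, $\omega_s=4\pi(\tilde\Gamma_{ss}+\Lambda_s)\in\mathbb R$, $\gamma=(4\pi|\tilde\Gamma_{+-}|)^2\ge0$. Singular spectrum. The singular spectrum of $H(\Gamma)$ (used interchangeably with the point spectrum, "eigenvalues") is the set of $E\in\mathbb R$ with $\det(\Gamma-Q(E))=0$, where $Q$ is the Krein $Q$-matrix function $Q_{ss'}(z)=\bigl\langle\psi_s,\frac{I+zH}{H-z}\frac1{H^2+I}\psi_{s'}\bigr\rangle$. For real $E$ this equation is taken in the explicit form $$\gamma=\prod_{s=\pm}\Bigl(\omega_s\pm\frac1{2\xi(E)}+s\beta\,\xi(E)\Bigr),\qquad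 \xi(E)=\frac1\beta\sqrt{\frac{-E}{2}\Bigl(1-\sqrt{1-(\beta/E)^2}\Bigr)},$$ with the upper sign for $E<\beta$ and the lower sign for $E\ge\beta$; square roots are principal, with $\sqrt{-t}=i\sqrt t$ for $t>0$; at $E=0$, $\beta>0$, the limit $E\downarrow0$ is taken in $\xi$; for $\beta=0$ the limit $\beta\downarrow0$ is taken, $\xi(E)=1/(2\sqrt{-E})$. "Embedded" means lying in $[-\beta,\infty)$. *)

theory Defs
  imports "HOL-Analysis.Analysis" "HOL-Real_Asymp.Real_Asymp"
begin

(* The spin index s = + is the index 1 and s = - is the index 2 of the type 2,
   so that g_+ = (1,0) and g_- = (0,1). *)

definition spin :: "2 \<Rightarrow> real" where
  "spin s = (if s = 1 then 1 else - 1)"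

definition hermitian :: "complex^'n^'n \<Rightarrow> bool" where
  "hermitian A \<longleftrightarrow> (\<forall>i j. A $ i $ j = cnj (A $ j $ i))"

definition nrm :: "real \<Rightarrow> 2 \<Rightarrow> real" where
  "nrm \<beta> s = 2 * root 4 2 * sqrt pi * root 4 (sqrt (1 + \<beta>\<^sup>2) + spin s * \<beta>)"

definition Gamma_tilde :: "real \<Rightarrow> complex^2^2 \<Rightarrow> complex^2^2" where
  "Gamma_tilde \<beta> \<Gamma> = (\<chi> s s'. \<Gamma> $ s $ s' / of_real (nrm \<beta> s * nrm \<beta> s'))"

definition Lam :: "real \<Rightarrow> 2 \<Rightarrow> real" where
  "Lam \<beta> s = - (1 / (8 * pi)) *
     (sqrt (sqrt (1 + \<beta>\<^sup>2) + 1) + spin s * sqrt (sqrt (1 + \<beta>\<^sup>2) - 1))"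

(* The diagonal of a Hermitian matrix is real, so Re loses nothing here. *)
definition omega :: "real \<Rightarrow> complex^2^2 \<Rightarrow> 2 \<Rightarrow> real" where
  "omega \<beta> \<Gamma> s = 4 * pi * (Re (Gamma_tilde \<beta> \<Gamma> $ s $ s) + Lam \<beta> s)"

definition gam :: "real \<Rightarrow> complex^2^2 \<Rightarrow> real" where
  "gam \<beta> \<Gamma> = (4 * pi * cmod (Gamma_tilde \<beta> \<Gamma> $ 1 $ 2))\<^sup>2"

(* For beta > 0 and E \<noteq> 0; csqrt is the principal root, with csqrt (-t) = i sqrt t for t > 0. *)
definition xi_formula :: "real \<Rightarrow> real \<Rightarrow> complex" where
  "xi_formula \<beta> E =
     1 / of_real \<beta> * csqrt (- of_real E / 2 * (1 - csqrt (1 - (of_real \<beta> / of_real E)\<^sup>2)))"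

definition xi_pos :: "real \<Rightarrow> real \<Rightarrow> complex" where
  "xi_pos \<beta> E = (if E = 0 then Lim (at_right 0) (xi_formula \<beta>) else xi_formula \<beta> E)"

(* "xi(E) is defined and equals x".  For beta = 0 this is the limit of xi(E) as beta decreases
   to 0, which exists unless E = 0 (see has_xi_zero below). *)
definition has_xi :: "real \<Rightarrow> real \<Rightarrow> complex \<Rightarrow> bool" where
  "has_xi \<beta> E x \<longleftrightarrow>
     (if \<beta> = 0 then ((\<lambda>b. xi_pos b E) \<longlongrightarrow> x) (at_right 0) else x = xi_pos \<beta> E)"

definition spectral_eq :: "real \<Rightarrow> complex^2^2 \<Rightarrow> real \<Rightarrow> complex \<Rightarrow> bool" where
  "spectral_eq \<beta> \<Gamma> E x \<longleftrightarrow>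
     of_real (gam \<beta> \<Gamma>) =
       (\<Prod>s\<in>UNIV. of_real (omega \<beta> \<Gamma> s) + (if E < \<beta> then 1 else - 1) / (2 * x)
                     + of_real (spin s * \<beta>) * x)"

(* The equation det (\<Gamma> - Q(E)) = 0 in the explicit form that fixes its meaning for real E.
   Off the spectrum of H the Krein Q-matrix is diagonal with
   Q_ss(z) = (nrm s)^2 / (4 pi) * (Re (csqrt (s beta - i)) - csqrt (s beta - z)), and
   Lam s = - Re (csqrt (s beta - i)) / (4 pi); for E < -beta the s-th factor of the product is
   omega s + sqrt (s beta - E) = 4 pi (\<Gamma>_ss - Q_ss(E)) / (nrm s)^2. *)
definition singular_spectrum :: "real \<Rightarrow> complex^2^2 \<Rightarrow> real set" where
  "singular_spectrum \<beta> \<Gamma> = {E. \<exists>x. has_xi \<beta> E x \<and> spectral_eq \<beta> \<Gamma> E x}"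


(* Checks that the limits in xi_pos and has_xi are the intended ones. *)

lemma xi_formula_tendsto:
  assumes "b > 0"
  shows "(xi_formula b \<longlongrightarrow> (1 + \<i>) / of_real (2 * sqrt b)) (at_right 0)"
proof -
  have ev: "eventually (\<lambda>e. xi_formula b e =
      (of_real (sqrt (b - e)) + \<i> * of_real (sqrt (b + e))) / of_real (2 * b)) (at_right 0)"
    using eventually_at_right_less[of "0::real"] eventually_at_right_real[OF assms]
  proof eventually_elim
    case (elim e)
    then have e: "0 < e" "e < b" by auto
    have 1: "(b / e)\<^sup>2 > 1"
      using e by (simp add: power2_eq_square field_simps mult_strict_mono)
    have "1 - (of_real b / of_real e)\<^sup>2 = complex_of_real (- ((b / e)\<^sup>2 - 1))"
      by simp
    also have "csqrt \<dots> = \<i> * of_real (sqrt ((b / e)\<^sup>2 - 1))"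
      using 1 by (subst csqrt_of_real_nonpos) auto
    finally have c: "csqrt (1 - (of_real b / of_real e)\<^sup>2) = \<i> * of_real (sqrt ((b / e)\<^sup>2 - 1))" .
    have "sqrt ((b / e)\<^sup>2 - 1) = sqrt ((b\<^sup>2 - e\<^sup>2) / e\<^sup>2)"
      using e by (simp add: field_simps)
    also have "\<dots> = sqrt (b\<^sup>2 - e\<^sup>2) / e"
      using e by (simp add: real_sqrt_divide)
    also have "b\<^sup>2 - e\<^sup>2 = (b - e) * (b + e)"
      by (simp add: power2_eq_square algebra_simps)
    finally have r: "sqrt ((b / e)\<^sup>2 - 1) = sqrt (b - e) * sqrt (b + e) / e"
      by (simp add: real_sqrt_mult)
    define w where "w = (complex_of_real (sqrt (b - e)) + \<i> * of_real (sqrt (b + e))) / 2"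
    have sq: "(complex_of_real (sqrt (b - e)))\<^sup>2 = of_real (b - e)"
             "(complex_of_real (sqrt (b + e)))\<^sup>2 = of_real (b + e)"
      using e by (simp_all flip: of_real_power)
    have "w\<^sup>2 = ((complex_of_real (sqrt (b - e)))\<^sup>2 - (complex_of_real (sqrt (b + e)))\<^sup>2
        + 2 * \<i> * of_real (sqrt (b - e) * sqrt (b + e))) / 4"
      unfolding w_def by (simp add: power2_eq_square field_simps)
    also have "\<dots> = - of_real e / 2 * (1 - \<i> * of_real (sqrt (b - e) * sqrt (b + e) / e))"
      unfolding sq using e by (simp add: field_simps)
    finally have w2: "w\<^sup>2 = - of_real e / 2 * (1 - csqrt (1 - (of_real b / of_real e)\<^sup>2))"
      by (simp only: c r)
    have "csqrt (w\<^sup>2) = w"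
      using e by (intro csqrt_square) (auto simp: w_def)
    then show ?case
      by (simp only: xi_formula_def w2[symmetric]) (simp add: w_def)
  qed
  have "((\<lambda>e. (of_real (sqrt (b - e)) + \<i> * of_real (sqrt (b + e))) / of_real (2 * b)) \<longlongrightarrow>
      (of_real (sqrt (b - 0)) + \<i> * of_real (sqrt (b + 0))) / complex_of_real (2 * b)) (at_right 0)"
    using assms by (intro tendsto_intros) auto
  moreover have "(of_real (sqrt (b - 0)) + \<i> * of_real (sqrt (b + 0))) / complex_of_real (2 * b) =
      (1 + \<i>) / of_real (2 * sqrt b)"
  proof -
    have "complex_of_real b = of_real (sqrt b) * of_real (sqrt b)"
      using assms by (simp flip: of_real_mult)
    then show ?thesis
      using assms by (simp add: field_simps)
  qed
  ultimately show ?thesis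
    by (simp add: tendsto_cong[OF ev])
qed

lemma xi_pos_0: "b > 0 \<Longrightarrow> xi_pos b 0 = (1 + \<i>) / of_real (2 * sqrt b)"
  unfolding xi_pos_def using tendsto_Lim[OF _ xi_formula_tendsto] by simp

lemma not_has_xi_zero_zero: "\<not> has_xi 0 0 x"
proof
  assume "has_xi 0 0 x"
  then have "((\<lambda>b. xi_pos b 0) \<longlongrightarrow> x) (at_right 0)"
    by (simp add: has_xi_def)
  then have lim: "((\<lambda>b. Re (xi_pos b 0)) \<longlongrightarrow> Re x) (at_right 0)"
    by (rule tendsto_Re)
  have "filterlim (\<lambda>b::real. 1 / (2 * sqrt b)) at_top (at_right 0)"
    by real_asymp
  moreover have "eventually (\<lambda>b. 1 / (2 * sqrt b) = Re (xi_pos b 0)) (at_right 0)"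
    using eventually_at_right_less[of "0::real"]
    by eventually_elim (simp add: xi_pos_0 Re_divide_of_real del: of_real_mult)
  ultimately have "filterlim (\<lambda>b. Re (xi_pos b 0)) at_top (at_right 0)"
    by (rule filterlim_mono_eventually[OF _ order_refl order_refl])
  with lim show False
    using not_tendsto_and_filterlim_at_infinity filterlim_at_top_imp_at_infinity
      trivial_limit_at_right_real by blast
qed

lemma xi_zero:
  assumes "E \<noteq> 0"
  shows "((\<lambda>b. xi_pos b E) \<longlongrightarrow> (if E < 0 then 1 else \<i>) / of_real (2 * sqrt \<bar>E\<bar>)) (at_right 0)"
proof -
  define u where "u = (if E < 0 then 1 else \<i>)"
  have u2: "u\<^sup>2 = - of_real (sgn E)"
    using assms by (auto simp: u_def)
  define r where "r b = sqrt (1 - (b / E)\<^sup>2)" for b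
  define y where "y b = 1 / sqrt (2 * \<bar>E\<bar> * (1 + r b))" for b
  have "\<bar>E\<bar> > 0" using assms by simp
  from eventually_at_right_real[OF this]
  have ev: "eventually (\<lambda>b. xi_pos b E = u * of_real (y b)) (at_right 0)"
  proof eventually_elim
    case (elim b)
    then have b: "0 < b" "b < \<bar>E\<bar>" by auto
    have "\<bar>b / E\<bar> \<le> 1"
      using b by simp
    then have 1: "(b / E)\<^sup>2 \<le> 1"
      by (simp only: abs_square_le_1)
    then have r: "(r b)\<^sup>2 = 1 - (b / E)\<^sup>2" "r b \<ge> 0"
      by (auto simp: r_def)
    have c: "csqrt (1 - (of_real b / of_real E)\<^sup>2) = of_real (r b)"
    proof -
      have "1 - (of_real b / of_real E)\<^sup>2 = complex_of_real (1 - (b / E)\<^sup>2)" by simp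
      then show ?thesis
        using 1 by (metis diff_ge_0_iff_ge of_real_sqrt r_def)
    qed
    have y: "(y b)\<^sup>2 = 1 / (2 * \<bar>E\<bar> * (1 + r b))" "y b > 0"
      using r(2) assms by (auto simp: y_def power_divide intro!: mult_pos_pos add_pos_nonneg)
    have "(1 - r b) * (1 + r b) = (b / E)\<^sup>2"
      using r(1) by (simp add: power2_eq_square algebra_simps)
    then have "1 - r b = (b / E)\<^sup>2 / (1 + r b)"
      using r(2) by (subst nonzero_eq_divide_eq) auto
    then have "- E / 2 * (1 - r b) = - sgn E * b\<^sup>2 * (y b)\<^sup>2"
      using assms r(2) unfolding y(1)
      by (cases "E < 0") (simp_all add: power2_eq_square)
    then have "complex_of_real (- E / 2 * (1 - r b)) = - of_real (sgn E) * (of_real (b * y b))\<^sup>2"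
      by (simp add: power_mult_distrib)
    also have "\<dots> = (u * of_real (b * y b))\<^sup>2"
      by (simp add: power_mult_distrib u2)
    finally have "- of_real E / 2 * (1 - csqrt (1 - (of_real b / of_real E)\<^sup>2)) =
        (u * of_real (b * y b))\<^sup>2"
      unfolding c by simp
    moreover have "csqrt ((u * of_real (b * y b))\<^sup>2) = u * of_real (b * y b)"
      using b y by (intro csqrt_square) (auto simp: u_def)
    ultimately show ?case
      using assms b by (simp only: xi_pos_def xi_formula_def if_False) simp
  qed
  have "(y \<longlongrightarrow> 1 / sqrt (2 * \<bar>E\<bar> * (1 + sqrt (1 - (0 / E)\<^sup>2)))) (at_right 0)"
    unfolding y_def[abs_def] r_def using assms by (intro tendsto_intros) auto
  moreover have "1 / sqrt (2 * \<bar>E\<bar> * (1 + sqrt (1 - (0 / E)\<^sup>2))) = 1 / (2 * sqrt \<bar>E\<bar>)"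
    by (simp add: real_sqrt_mult)
  ultimately have "((\<lambda>b. u * of_real (y b)) \<longlongrightarrow> u * of_real (1 / (2 * sqrt \<bar>E\<bar>))) (at_right 0)"
    by (intro tendsto_intros) simp
  then show ?thesis
    unfolding u_def[symmetric] tendsto_cong[OF ev] by simp
qed

lemma csqrt_minus_of_real:
  "csqrt (- of_real E) = (if E < 0 then 1 else \<i>) * of_real (sqrt \<bar>E\<bar>)"
proof -
  have "csqrt (- of_real E) = csqrt (of_real (- E))" by simp
  also have "\<dots> = (if E < 0 then 1 else \<i>) * of_real (sqrt \<bar>E\<bar>)"
    by (cases "E < 0") (auto simp: csqrt_of_real_nonpos simp del: of_real_minus)
  finally show ?thesis .
qed

lemma has_xi_zero:
  "has_xi 0 E x \<longleftrightarrow>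
     E \<noteq> 0 \<and> x = (if E < 0 then 1 else - 1) * (1 / (2 * csqrt (- of_real E)))"
proof (cases "E = 0")
  case False
  have "has_xi 0 E x \<longleftrightarrow> x = (if E < 0 then 1 else \<i>) / of_real (2 * sqrt \<bar>E\<bar>)"
    unfolding has_xi_def
    using xi_zero[OF False] tendsto_unique[OF trivial_limit_at_right_real] by auto
  also have "(if E < 0 then 1 else \<i>) / of_real (2 * sqrt \<bar>E\<bar>) =
      (if E < 0 then 1 else - 1) * (1 / (2 * csqrt (- of_real E)))"
    using False by (simp add: csqrt_minus_of_real divide_simps)
  finally show ?thesis using False by simp
qed (simp add: not_has_xi_zero_zero)

(* The limit is 1 / (2 csqrt (-E)) for E < 0 and its complex conjugate for E > 0; both choices
   of the root give the same equation, whose other coefficients are real. *)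
lemma singular_spectrum_zero:
  "singular_spectrum 0 \<Gamma> = {E. E \<noteq> 0 \<and> spectral_eq 0 \<Gamma> E (1 / (2 * csqrt (- of_real E)))}"
proof -
  have conj: "spectral_eq 0 \<Gamma> E (- (1 / (2 * csqrt (- of_real E)))) \<longleftrightarrow>
        spectral_eq 0 \<Gamma> E (1 / (2 * csqrt (- of_real E)))" if "E > 0" for E
  proof -
    define q where "q = 1 / (2 * csqrt (- of_real E))"
    have q: "cnj q = - q"
      using that by (simp add: q_def csqrt_minus_of_real)
    have "cnj (\<Prod>s\<in>UNIV. of_real (omega 0 \<Gamma> s) + (- 1) / (2 * q) + of_real (spin s * 0) * q) =
          (\<Prod>s\<in>UNIV. of_real (omega 0 \<Gamma> s) + (- 1) / (2 * - q) + of_real (spin s * 0) * - q)"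
      by (simp add: q)
    moreover have "cnj (of_real (gam 0 \<Gamma>)) = of_real (gam 0 \<Gamma>)" by simp
    ultimately show ?thesis
      unfolding spectral_eq_def q_def[symmetric] if_not_P[OF less_not_sym[OF that]]
      by (metis (no_types, lifting) complex_cnj_cancel_iff)
  qed
  show ?thesis
    unfolding singular_spectrum_def
  proof (intro Collect_cong)
    fix E
    show "(\<exists>x. has_xi 0 E x \<and> spectral_eq 0 \<Gamma> E x) \<longleftrightarrow>
        E \<noteq> 0 \<and> spectral_eq 0 \<Gamma> E (1 / (2 * csqrt (- of_real E)))"
      using conj[of E] by (cases "E < 0"; cases "E = 0") (simp_all only: has_xi_zero, auto)
  qed
qed

end

theory Submission
  imports Defs
begin

text \<open>
  The function \<open>\<xi>\<close> has the form \<open>(p - q) / (2 \<beta>)\<close>, where \<open>p\<close> and \<open>q\<close> are square roots of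
  \<open>\<beta> - E\<close> and \<open>-\<beta> - E\<close> for \<open>E < \<beta>\<close>, and of \<open>-\<beta> - E\<close> and \<open>\<beta> - E\<close> for \<open>E \<ge> \<beta>\<close>. Since
  \<open>p\<^sup>2 - q\<^sup>2 = \<plusminus>2 \<beta>\<close>, the term \<open>\<plusminus>1 / (2 \<xi>)\<close> is \<open>(p + q) / 2\<close>, so the equation factors as
  \<open>\<gamma> = (\<omega>\<^sub>+ + p) (\<omega>\<^sub>- + q)\<close>. Below the threshold both roots are real. On \<open>[-\<beta>, \<beta>)\<close> the root
  \<open>p\<close> is real and \<open>q\<close> imaginary, and on \<open>[\<beta>, \<infinity>)\<close> both are imaginary; since \<open>\<gamma>\<close> and the
  \<open>\<omega>\<^sub>\<plusminus>\<close> are real, comparing real and imaginary parts leaves only the listed points. Above \<open>\<beta>\<close>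
  the real part of the product is negative once its imaginary part vanishes, whereas \<open>\<gamma> \<ge> 0\<close>.
\<close>

section \<open>Closed form of \<open>\<xi>\<close> as a difference of two square roots\<close>

lemma sqrt_one_minus_square_quotient:
  fixes \<beta> E :: real
  assumes "E \<noteq> 0"
  shows "sqrt \<bar>1 - (\<beta> / E)\<^sup>2\<bar> = sqrt \<bar>\<beta> - E\<bar> * sqrt \<bar>\<beta> + E\<bar> / \<bar>E\<bar>"
proof -
  have "1 - (\<beta> / E)\<^sup>2 = - ((\<beta> - E) * (\<beta> + E)) / E\<^sup>2"
    using assms by (simp add: power2_eq_square field_simps)
  then have "\<bar>1 - (\<beta> / E)\<^sup>2\<bar> = \<bar>\<beta> - E\<bar> * \<bar>\<beta> + E\<bar> / E\<^sup>2"
    by (simp add: abs_mult)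
  then show ?thesis
    by (simp add: real_sqrt_mult real_sqrt_divide)
qed

lemma csqrt_of_real_if:
  "csqrt (of_real x) = (if 0 \<le> x then 1 else \<i>) * of_real (sqrt \<bar>x\<bar>)"
  by (cases "0 \<le> x") (simp_all add: csqrt_of_real_nonneg csqrt_of_real_nonpos)

text \<open>The radicand is real, and it is negative exactly when the modulus of \<open>E\<close> is
  below \<open>\<beta>\<close>; there the principal root is a positive multiple of
  \<open>\<i>\<close>.\<close>

lemma csqrt_one_minus_square_quotient:
  assumes "\<beta> \<ge> 0" "E \<noteq> 0"
  shows "csqrt (1 - (of_real \<beta> / of_real E)\<^sup>2) = (if \<beta> \<le> \<bar>E\<bar> then 1 else \<i>) *
           of_real (sqrt \<bar>\<beta> - E\<bar> * sqrt \<bar>\<beta> + E\<bar> / \<bar>E\<bar>)"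
proof -
  have "(\<beta> / E)\<^sup>2 \<le> 1 \<longleftrightarrow> \<bar>\<beta> / E\<bar> \<le> 1"
    by (rule abs_square_le_1)
  also have "\<dots> \<longleftrightarrow> \<beta> \<le> \<bar>E\<bar>"
    using assms by (simp add: divide_le_eq_1)
  finally have 1: "0 \<le> 1 - (\<beta> / E)\<^sup>2 \<longleftrightarrow> \<beta> \<le> \<bar>E\<bar>" by simp
  have "1 - (of_real \<beta> / of_real E)\<^sup>2 = complex_of_real (1 - (\<beta> / E)\<^sup>2)"
    by simp
  then show ?thesis
    using 1 by (simp only: csqrt_of_real_if sqrt_one_minus_square_quotient[OF assms(2)])
qed

text \<open>The left side of \<open>prod\<close> is the inner root of \<open>xi_formula\<close>.
  With \<open>sum\<close> it makes the outer radicand the square of \<open>(p - q) / 2\<close>, and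
  \<open>pos\<close> says that \<open>(p - q) / 2\<close> is the principal root of that
  square.\<close>

lemma xi_formula_eqI:
  assumes "\<beta> > 0" "E \<noteq> 0"
    and sum: "p\<^sup>2 + q\<^sup>2 = - 2 * of_real E"
    and prod: "(if \<beta> \<le> \<bar>E\<bar> then 1 else \<i>) * of_real (sqrt \<bar>\<beta> - E\<bar> * sqrt \<bar>\<beta> + E\<bar> / \<bar>E\<bar>) =
      - (p * q) / of_real E"
    and pos: "0 < Re (p - q) \<or> Re (p - q) = 0 \<and> 0 \<le> Im (p - q)"
  shows "xi_formula \<beta> E = (p - q) / of_real (2 * \<beta>)"
proof -
  have root: "csqrt (1 - (of_real \<beta> / of_real E)\<^sup>2) = - (p * q) / of_real E"
    unfolding csqrt_one_minus_square_quotient[OF less_imp_le[OF assms(1)] assms(2)] prod ..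
  have "((p - q) / 2)\<^sup>2 = (p\<^sup>2 + q\<^sup>2 - 2 * (p * q)) / 4"
    by (simp add: power2_eq_square field_simps)
  also have "\<dots> = - of_real E / 2 * (1 - csqrt (1 - (of_real \<beta> / of_real E)\<^sup>2))"
    unfolding sum root using assms(2) by (simp add: field_simps)
  finally have "xi_formula \<beta> E = 1 / of_real \<beta> * csqrt (((p - q) / 2)\<^sup>2)"
    by (simp only: xi_formula_def)
  also have "csqrt (((p - q) / 2)\<^sup>2) = (p - q) / 2"
    using pos by (intro csqrt_square) auto
  finally show ?thesis by simp
qed

lemma of_real_sqrt_power2:
  "x \<ge> 0 \<Longrightarrow> (of_real (sqrt x))\<^sup>2 = complex_of_real x"
  by (simp flip: of_real_power)

lemma xi_pos_less_minus:
  assumes "\<beta> > 0" "E < - \<beta>"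
  shows "xi_pos \<beta> E = (of_real (sqrt (\<beta> - E)) - of_real (sqrt (- \<beta> - E))) / of_real (2 * \<beta>)"
proof -
  have "xi_formula \<beta> E = (of_real (sqrt (\<beta> - E)) - of_real (sqrt (- \<beta> - E))) / of_real (2 * \<beta>)"
    using assms
    by (intro xi_formula_eqI)
      (auto simp: of_real_sqrt_power2 abs_if field_simps)
  then show ?thesis
    using assms by (simp add: xi_pos_def)
qed

text \<open>The inner root \<open>- (p * q) / E\<close> must keep a nonnegative imaginary part, so
  the imaginary root \<open>q\<close> changes sign with \<open>E\<close>. The limit from the right
  at \<open>E = 0\<close> agrees with the branch \<open>E > 0\<close>.\<close>

lemma xi_pos_between:
  assumes "- \<beta> \<le> E" "E < \<beta>"
  shows "xi_pos \<beta> E = (of_real (sqrt (\<beta> - E)) -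
           (if E < 0 then 1 else - 1) * \<i> * of_real (sqrt (\<beta> + E))) / of_real (2 * \<beta>)"
proof (cases "E = 0")
  case True
  have "\<beta> > 0" using assms by simp
  moreover from this have "complex_of_real \<beta> = of_real (sqrt \<beta>) * of_real (sqrt \<beta>)"
    by (simp flip: of_real_mult)
  ultimately show ?thesis
    using True by (simp add: xi_pos_0 field_simps)
next
  case False
  then have "xi_formula \<beta> E = (of_real (sqrt (\<beta> - E)) -
               (if E < 0 then 1 else - 1) * \<i> * of_real (sqrt (\<beta> + E))) / of_real (2 * \<beta>)"
    using assms
    by (intro xi_formula_eqI)
      (auto simp: of_real_sqrt_power2 power_mult_distrib
        abs_if field_simps)
  then show ?thesis
    using False by (simp add: xi_pos_def)
qed

text \<open>Here \<open>p - q\<close> is purely imaginary, so the principal root is decided by its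
  imaginary part; this forces the larger root to come first, a root of
  \<open>- \<beta> - E\<close>.\<close>

lemma xi_pos_ge:
  assumes "\<beta> > 0" "\<beta> \<le> E"
  shows "xi_pos \<beta> E =
    (\<i> * of_real (sqrt (E + \<beta>)) - \<i> * of_real (sqrt (E - \<beta>))) / of_real (2 * \<beta>)"
proof -
  have "xi_formula \<beta> E =
      (\<i> * of_real (sqrt (E + \<beta>)) - \<i> * of_real (sqrt (E - \<beta>))) / of_real (2 * \<beta>)"
    using assms
    by (intro xi_formula_eqI)
      (auto simp: of_real_sqrt_power2 power_mult_distrib
        abs_if field_simps)
  then show ?thesis
    using assms by (simp add: xi_pos_def)
qed

section \<open>The spectral equation in factored form\<close>

lemma spin_simps [simp]: "spin 1 = 1" "spin 2 = - 1"
  by (simp_all add: spin_def)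

lemma prod_UNIV_2: "(\<Prod>s\<in>(UNIV :: 2 set). f s) = f 1 * f 2"
  by (simp add: UNIV_2)

text \<open>Stated for arbitrary complex \<open>p\<close> and \<open>q\<close>, so that one
  factorization serves all three energy ranges.\<close>

lemma spectral_eq_factored:
  assumes "\<beta> > 0" and x: "x = (p - q) / of_real (2 * \<beta>)"
    and diff: "p\<^sup>2 - q\<^sup>2 = (if E < \<beta> then 1 else - 1) * of_real (2 * \<beta>)"
  shows "spectral_eq \<beta> \<Gamma> E x \<longleftrightarrow>
    of_real (gam \<beta> \<Gamma>) = (of_real (omega \<beta> \<Gamma> 1) + p) * (of_real (omega \<beta> \<Gamma> 2) + q)"
proof -
  define \<epsilon> :: complex where "\<epsilon> = (if E < \<beta> then 1 else - 1)"
  have b: "of_real \<beta> \<noteq> (0 :: complex)" using assms(1) by simp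
  have prod: "(p - q) * (p + q) = 2 * \<epsilon> * of_real \<beta>"
    using diff by (simp add: \<epsilon>_def power2_eq_square algebra_simps split: if_splits)
  \<comment> \<open>This makes \<open>\<epsilon> / (2 * x)\<close> a genuine quotient and not the
    default value of division by zero.\<close>
  then have "p - q \<noteq> 0"
    using b by (auto simp: \<epsilon>_def split: if_splits)
  then have "x \<noteq> 0"
    using b unfolding x by simp
  moreover have "\<epsilon> = x * (p + q)"
    using b prod unfolding x by (simp add: field_simps)
  ultimately have e: "\<epsilon> / (2 * x) = (p + q) / 2"
    by simp
  have bx: "of_real \<beta> * x = (p - q) / 2"
    using b unfolding x by simp
  have "w + \<epsilon> / (2 * x) + of_real (spin 1 * \<beta>) * x = w + p" for w
    unfolding e by (simp add: bx) (simp add: field_simps)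
  moreover have "w + \<epsilon> / (2 * x) + of_real (spin 2 * \<beta>) * x = w + q" for w
    unfolding e by (simp add: bx) (simp add: field_simps)
  ultimately show ?thesis
    by (simp only: spectral_eq_def prod_UNIV_2 flip: \<epsilon>_def)
qed

lemma gam_nonneg: "gam \<beta> \<Gamma> \<ge> 0"
  by (simp add: gam_def)

section \<open>The three energy ranges for \<open>\<beta> > 0\<close>\<close>

lemma mem_singular_spectrum_pos:
  "\<beta> > 0 \<Longrightarrow> E \<in> singular_spectrum \<beta> \<Gamma> \<longleftrightarrow> spectral_eq \<beta> \<Gamma> E (xi_pos \<beta> E)"
  by (simp add: singular_spectrum_def has_xi_def)

lemma mem_singular_spectrum_less_minus:
  assumes "\<beta> > 0" "E < - \<beta>"
  shows "E \<in> singular_spectrum \<beta> \<Gamma> \<longleftrightarrow>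
    gam \<beta> \<Gamma> = (omega \<beta> \<Gamma> 1 + sqrt (\<beta> - E)) * (omega \<beta> \<Gamma> 2 + sqrt (- \<beta> - E))"
proof -
  have "E \<in> singular_spectrum \<beta> \<Gamma> \<longleftrightarrow> complex_of_real (gam \<beta> \<Gamma>) =
      (of_real (omega \<beta> \<Gamma> 1) + of_real (sqrt (\<beta> - E))) *
      (of_real (omega \<beta> \<Gamma> 2) + of_real (sqrt (- \<beta> - E)))"
    unfolding mem_singular_spectrum_pos[OF assms(1)]
    using assms by (intro spectral_eq_factored xi_pos_less_minus) (auto simp: of_real_sqrt_power2)
  then show ?thesis
    by (simp only: of_real_eq_iff flip: of_real_add of_real_mult)
qed

lemma mem_singular_spectrum_between:
  assumes "- \<beta> \<le> E" "E < \<beta>"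
  shows "E \<in> singular_spectrum \<beta> \<Gamma> \<longleftrightarrow>
    gam \<beta> \<Gamma> = (omega \<beta> \<Gamma> 1 + sqrt (\<beta> - E)) * omega \<beta> \<Gamma> 2 \<and>
    (E = - \<beta> \<or> omega \<beta> \<Gamma> 1 = - sqrt (\<beta> - E))"
proof -
  have b: "\<beta> > 0" using assms by simp
  have "E \<in> singular_spectrum \<beta> \<Gamma> \<longleftrightarrow> complex_of_real (gam \<beta> \<Gamma>) =
      (of_real (omega \<beta> \<Gamma> 1) + of_real (sqrt (\<beta> - E))) *
      (of_real (omega \<beta> \<Gamma> 2) + (if E < 0 then 1 else - 1) * \<i> * of_real (sqrt (\<beta> + E)))"
    unfolding mem_singular_spectrum_pos[OF b] using assms b
    by (intro spectral_eq_factored xi_pos_between)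
      (auto simp: of_real_sqrt_power2 power_mult_distrib)
  \<comment> \<open>The imaginary part only has to vanish, so the sign of the imaginary root drops
    out. At \<open>E = - \<beta>\<close> that root is zero and the imaginary part imposes
    nothing.\<close>
  also have "\<dots> \<longleftrightarrow> gam \<beta> \<Gamma> = (omega \<beta> \<Gamma> 1 + sqrt (\<beta> - E)) * omega \<beta> \<Gamma> 2 \<and>
      (omega \<beta> \<Gamma> 1 + sqrt (\<beta> - E)) * sqrt (\<beta> + E) = 0"
    by (auto simp: complex_eq_iff)
  finally show ?thesis
    using assms by (auto simp: add_eq_0_iff)
qed

lemma mem_singular_spectrum_ge:
  assumes "\<beta> > 0" "\<beta> \<le> E"
  shows "E \<in> singular_spectrum \<beta> \<Gamma> \<longleftrightarrow> E = \<beta> \<and> gam \<beta> \<Gamma> = 0 \<and> omega \<beta> \<Gamma> 2 = 0"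
proof -
  define a b where "a = sqrt (E - \<beta>)" and "b = sqrt (E + \<beta>)"
  have b: "b > 0" and a: "a \<ge> 0" and a0: "a = 0 \<longleftrightarrow> E = \<beta>"
    using assms by (auto simp: a_def b_def)
  let ?w1 = "omega \<beta> \<Gamma> 1" and ?w2 = "omega \<beta> \<Gamma> 2"
  have "E \<in> singular_spectrum \<beta> \<Gamma> \<longleftrightarrow> complex_of_real (gam \<beta> \<Gamma>) =
      (of_real ?w1 + \<i> * of_real b) * (of_real ?w2 + \<i> * of_real a)"
    unfolding mem_singular_spectrum_pos[OF assms(1)] a_def b_def using assms
    by (intro spectral_eq_factored xi_pos_ge)
      (auto simp: of_real_sqrt_power2 power_mult_distrib)
  also have "\<dots> \<longleftrightarrow> gam \<beta> \<Gamma> = ?w1 * ?w2 - b * a \<and> ?w1 * a + b * ?w2 = 0"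
    by (auto simp: complex_eq_iff)
  also have "\<dots> \<longleftrightarrow> a = 0 \<and> gam \<beta> \<Gamma> = 0 \<and> ?w2 = 0"
  proof safe
    assume g: "gam \<beta> \<Gamma> = ?w1 * ?w2 - b * a" and im: "?w1 * a + b * ?w2 = 0"
    \<comment> \<open>Multiplying the real part by \<open>b\<close> lets the imaginary part
      eliminate \<open>?w2\<close>. The result is a nonnegative number equal to a negative multiple
      of \<open>a \<ge> 0\<close>, hence \<open>a = 0\<close>.\<close>
    have "b * gam \<beta> \<Gamma> = ?w1 * (b * ?w2) - b\<^sup>2 * a"
      unfolding g by (simp add: power2_eq_square algebra_simps)
    also have "b * ?w2 = - (?w1 * a)" using im by simp
    finally have eq: "b * gam \<beta> \<Gamma> = - ((?w1\<^sup>2 + b\<^sup>2) * a)"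
      by (simp add: power2_eq_square algebra_simps)
    have "b * gam \<beta> \<Gamma> \<ge> 0"
      using b gam_nonneg by simp
    moreover have "?w1\<^sup>2 + b\<^sup>2 > 0"
      using b by (simp add: add_nonneg_pos)
    ultimately show "a = 0"
      using a eq by (metis antisym mult_pos_pos neg_0_le_iff_le not_less order_le_less)
    with im b g show "?w2 = 0" "gam \<beta> \<Gamma> = 0" by auto
  qed auto
  finally show ?thesis unfolding a0 .
qed

section \<open>The case \<open>\<beta> = 0\<close>\<close>

lemma mem_singular_spectrum_zero_neg:
  assumes "E < 0"
  shows "E \<in> singular_spectrum 0 \<Gamma> \<longleftrightarrow>
    gam 0 \<Gamma> = (omega 0 \<Gamma> 1 + sqrt (- E)) * (omega 0 \<Gamma> 2 + sqrt (- E))"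
proof -
  have "E \<in> singular_spectrum 0 \<Gamma> \<longleftrightarrow> complex_of_real (gam 0 \<Gamma>) =
      (of_real (omega 0 \<Gamma> 1) + of_real (sqrt (- E))) * (of_real (omega 0 \<Gamma> 2) + of_real (sqrt (- E)))"
    using assms
    by (simp add: singular_spectrum_zero spectral_eq_def prod_UNIV_2 csqrt_minus_of_real)
  then show ?thesis
    by (simp only: of_real_eq_iff flip: of_real_add of_real_mult)
qed

lemma not_mem_singular_spectrum_zero:
  assumes "E \<ge> 0"
  shows "E \<notin> singular_spectrum 0 \<Gamma>"
proof
  let ?w1 = "omega 0 \<Gamma> 1" and ?w2 = "omega 0 \<Gamma> 2"
  assume "E \<in> singular_spectrum 0 \<Gamma>"
  \<comment> \<open>The value \<open>E = 0\<close> is excluded because \<open>\<xi>\<close> has no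
    limit there as \<open>\<beta>\<close> decreases to zero.\<close>
  then have E: "E > 0" and "complex_of_real (gam 0 \<Gamma>) =
      (of_real ?w1 - \<i> * of_real (sqrt E)) * (of_real ?w2 - \<i> * of_real (sqrt E))"
    using assms
    by (auto simp: singular_spectrum_zero spectral_eq_def prod_UNIV_2 csqrt_minus_of_real)
  then have g: "gam 0 \<Gamma> = ?w1 * ?w2 - E" and im: "(?w1 + ?w2) * sqrt E = 0"
    using assms by (auto simp: complex_eq_iff algebra_simps)
  have "?w2 = - ?w1" using im E by (simp add: add_eq_0_iff)
  with g have "gam 0 \<Gamma> = - (?w1\<^sup>2) - E"
    by (simp add: power2_eq_square)
  moreover have "?w1\<^sup>2 \<ge> 0" by simp
  ultimately show False
    using gam_nonneg[of 0 \<Gamma>] E by linarith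
qed

section \<open>Assembly of the singular spectrum from the energy ranges\<close>

theorem theorem6p1:
  fixes \<beta> :: real and \<Gamma> R :: "complex^2^2"
  assumes "0 \<le> \<beta>" and "hermitian \<Gamma>" and "hermitian R" and "\<Gamma> \<noteq> - R"
  shows
    "{E \<in> singular_spectrum \<beta> \<Gamma>. E < - \<beta>} =
       {E. E < - \<beta> \<and> gam \<beta> \<Gamma> = (\<Prod>s\<in>UNIV. omega \<beta> \<Gamma> s + sqrt (spin s * \<beta> - E))} \<and>
     (\<beta> > 0 \<longrightarrow>
       {E \<in> singular_spectrum \<beta> \<Gamma>. E \<ge> - \<beta>} =
         (if gam \<beta> \<Gamma> = (omega \<beta> \<Gamma> 1 + sqrt (2 * \<beta>)) * omega \<beta> \<Gamma> 2 then {- \<beta>} else {}) \<union>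
         (if gam \<beta> \<Gamma> = 0 \<and> - sqrt (2 * \<beta>) < omega \<beta> \<Gamma> 1 \<and> omega \<beta> \<Gamma> 1 < 0
            then {\<beta> - (omega \<beta> \<Gamma> 1)\<^sup>2} else {}) \<union>
         (if gam \<beta> \<Gamma> = 0 \<and> omega \<beta> \<Gamma> 2 = 0 then {\<beta>} else {})) \<and>
     (\<beta> = 0 \<longrightarrow> {E \<in> singular_spectrum \<beta> \<Gamma>. E \<ge> - \<beta>} = {})"
proof (intro conjI impI)
  show "{E \<in> singular_spectrum \<beta> \<Gamma>. E < - \<beta>} =
      {E. E < - \<beta> \<and> gam \<beta> \<Gamma> = (\<Prod>s\<in>UNIV. omega \<beta> \<Gamma> s + sqrt (spin s * \<beta> - E))}"
  proof (cases "\<beta> = 0")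
    case True
    then show ?thesis by (auto simp: mem_singular_spectrum_zero_neg prod_UNIV_2)
  next
    case False
    with assms(1) have "\<beta> > 0" by simp
    then show ?thesis by (auto simp: mem_singular_spectrum_less_minus prod_UNIV_2)
  qed
next
  assume b: "\<beta> > 0"
  let ?w1 = "omega \<beta> \<Gamma> 1" and ?w2 = "omega \<beta> \<Gamma> 2"
  have "E \<in> singular_spectrum \<beta> \<Gamma> \<and> - \<beta> \<le> E \<longleftrightarrow>
      E = - \<beta> \<and> gam \<beta> \<Gamma> = (?w1 + sqrt (2 * \<beta>)) * ?w2 \<or>
      E = \<beta> - ?w1\<^sup>2 \<and> gam \<beta> \<Gamma> = 0 \<and> - sqrt (2 * \<beta>) < ?w1 \<and> ?w1 < 0 \<or>
      E = \<beta> \<and> gam \<beta> \<Gamma> = 0 \<and> ?w2 = 0" (is "?L E \<longleftrightarrow> ?R E") for E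
  proof -
    have w1: "?w1 = - sqrt (\<beta> - E) \<longleftrightarrow> E = \<beta> - ?w1\<^sup>2 \<and> - sqrt (2 * \<beta>) < ?w1 \<and> ?w1 < 0"
      if E: "- \<beta> < E" "E < \<beta>"
    proof
      assume w: "?w1 = - sqrt (\<beta> - E)"
      have "sqrt (\<beta> - E) < sqrt (2 * \<beta>)" using E by simp
      then show "E = \<beta> - ?w1\<^sup>2 \<and> - sqrt (2 * \<beta>) < ?w1 \<and> ?w1 < 0"
        using w E by simp
    next
      assume "E = \<beta> - ?w1\<^sup>2 \<and> - sqrt (2 * \<beta>) < ?w1 \<and> ?w1 < 0"
      then have "\<beta> - E = ?w1\<^sup>2" "?w1 < 0" by auto
      then show "?w1 = - sqrt (\<beta> - E)" by simp
    qed
    \<comment> \<open>The strict bounds on \<open>?w1\<close> keep the second kind of eigenvalue off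
      both thresholds, so it can only arise in the third case below.\<close>
    have between: "- \<beta> < E \<and> E < \<beta>" if "E = \<beta> - ?w1\<^sup>2" "- sqrt (2 * \<beta>) < ?w1" "?w1 < 0"
    proof -
      have "(- ?w1)\<^sup>2 < (sqrt (2 * \<beta>))\<^sup>2"
        using that by (intro power_strict_mono) auto
      then show ?thesis using that b by simp
    qed
    consider "E < - \<beta>" | "E = - \<beta>" | "- \<beta> < E" "E < \<beta>" | "\<beta> \<le> E" by linarith
    then show ?thesis
    proof cases
      case 1
      then show ?thesis using between b by auto
    next
      case 2
      then show ?thesis using between b by (auto simp: mem_singular_spectrum_between)
    next
      case 3
      \<comment> \<open>Vanishing of the imaginary part kills the first factor, so the product
        equation reduces to \<open>gam \<beta> \<Gamma> = 0\<close>.\<close>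
      have "?L E \<longleftrightarrow> gam \<beta> \<Gamma> = 0 \<and> ?w1 = - sqrt (\<beta> - E)"
        using 3 by (auto simp: mem_singular_spectrum_between)
      then show ?thesis unfolding w1[OF 3] using 3 b by auto
    next
      case 4
      then show ?thesis using between b by (auto simp: mem_singular_spectrum_ge)
    qed
  qed
  then show "{E \<in> singular_spectrum \<beta> \<Gamma>. E \<ge> - \<beta>} =
      (if gam \<beta> \<Gamma> = (?w1 + sqrt (2 * \<beta>)) * ?w2 then {- \<beta>} else {}) \<union>
      (if gam \<beta> \<Gamma> = 0 \<and> - sqrt (2 * \<beta>) < ?w1 \<and> ?w1 < 0 then {\<beta> - ?w1\<^sup>2} else {}) \<union>
      (if gam \<beta> \<Gamma> = 0 \<and> ?w2 = 0 then {\<beta>} else {})"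
    by (intro set_eqI) (simp only: mem_Collect_eq Un_iff if_split_mem2, auto)
next
  assume "\<beta> = 0"
  then show "{E \<in> singular_spectrum \<beta> \<Gamma>. E \<ge> - \<beta>} = {}"
    by (auto dest: not_mem_singular_spectrum_zero)
qed

end
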